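(* Let $H$ be a graph without isolated vertices. Then any optimal online algorithm with advice for the Delayed $H$-Edge-Deletion Problem needs $\mathrm{opt} \cdot \log \|H\|$ bits of advice.
   Context: Graphs are finite, simple, undirected, with at least one vertex. $\|G\|$ is the number of edges of $G$; $\log$ is base 2. A graph $G$ is $H$-free if $H$ is not isomorphic to an induced subgraph of $G$. Delayed $H$-Edge-Deletion Problem: $H$ is a fixed graph with at least one edge. An instance is a graph $G$ with an ordering $v_1,\dots,v_n$ of its vertices. In step $i$, vertex $v_i$ and its adjacencies to $v_1,\dots,v_{i-1}$ are revealed, and the algorithm (not knowing the future vertices or $n$) must output a set $S_i\subseteq E(G[\{v_1,\dots,v_i\}])$ such that the graph $G[\{v_1,\dots,v_i\}]-S_i$ obtained by deleting the edges in $S_i$ is $H$-free; moreover $S_1\subseteq\dots\subseteq S_n$. The goal is to minimize $|S_n|$. For an instance, $\mathrm{opt}$ is the minimum size of a set $S\subseteq E(G)$ with $G-S$ $H$-free. An online algorithm with advice is deterministic, and additionally may sequentially read bits from an infinite binary tape. It is optimal if for every instance $I$ there is a tape content $\phi_I$ (chosen by an oracle knowing $I$) with which it outputs a solution of size $\mathrm{opt}(I)$ on $I$. "Any optimal online algorithm needs $b(\mathrm{opt})$ bits of advice" means: for every optimal online algorithm with advice, every choice of such tape contents $\phi_I$, and every integer $k\ge 1$, there is an instance $I$ with $\mathrm{opt}(I)=k$ on which the algorithm, run with $\phi_I$, reads at least $b(k)$ bits of the tape. *)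

theory Defs
  imports Complex_Main
begin

datatype 'a graph = Graph (verts: "'a set") (edges: "'a set set")

definition simple_graph :: "'a graph \<Rightarrow> bool" where
  "simple_graph G \<longleftrightarrow> finite (verts G) \<and> verts G \<noteq> {} \<and>
     (\<forall>e\<in>edges G. e \<subseteq> verts G \<and> card e = 2)"

definition num_edges :: "'a graph \<Rightarrow> nat" where
  "num_edges G = card (edges G)"

definition no_isolated_vertices :: "'a graph \<Rightarrow> bool" where
  "no_isolated_vertices G \<longleftrightarrow> (\<forall>v\<in>verts G. \<exists>e\<in>edges G. v \<in> e)"

definition isomorphic :: "'a graph \<Rightarrow> 'b graph \<Rightarrow> bool" where
  "isomorphic G G' \<longleftrightarrow>
     (\<exists>f. bij_betw f (verts G) (verts G') \<and>
          (\<forall>u\<in>verts G. \<forall>v\<in>verts G. {u, v} \<in> edges G \<longleftrightarrow> {f u, f v} \<in> edges G'))"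

definition induced :: "'a graph \<Rightarrow> 'a set \<Rightarrow> 'a graph" where
  "induced G X = Graph X {e \<in> edges G. e \<subseteq> X}"

definition H_free :: "'h graph \<Rightarrow> 'a graph \<Rightarrow> bool" where
  "H_free H G \<longleftrightarrow> \<not> (\<exists>X\<subseteq>verts G. isomorphic H (induced G X))"

definition delete_edges :: "'a graph \<Rightarrow> 'a set set \<Rightarrow> 'a graph" where
  "delete_edges G S = Graph (verts G) (edges G - S)"

definition opt :: "'h graph \<Rightarrow> 'a graph \<Rightarrow> nat" where
  "opt H G = Min (card ` {S. S \<subseteq> edges G \<and> H_free H (delete_edges G S)})"

text \<open>An online instance is a graph together with the list of its vertices in order of arrival.\<close>

type_synonym 'v inst = "'v graph \<times> 'v list"

definition is_inst :: "'v inst \<Rightarrow> bool" where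
  "is_inst I \<longleftrightarrow> simple_graph (fst I) \<and> distinct (snd I) \<and> set (snd I) = verts (fst I)"

text \<open>Everything that is known after the first \<open>i\<close> vertices have been revealed.\<close>

definition revealed :: "'v inst \<Rightarrow> nat \<Rightarrow> 'v inst" where
  "revealed I i = (induced (fst I) (set (take i (snd I))), take i (snd I))"

definition solution :: "'h graph \<Rightarrow> 'v inst \<Rightarrow> 'v set set list \<Rightarrow> bool" where
  "solution H I Ss \<longleftrightarrow> length Ss = length (snd I) \<and>
     (\<forall>i<length Ss. let G\<^sub>i = fst (revealed I (Suc i)) in
        Ss ! i \<subseteq> edges G\<^sub>i \<and> H_free H (delete_edges G\<^sub>i (Ss ! i))) \<and>
     (\<forall>i. Suc i < length Ss \<longrightarrow> Ss ! i \<subseteq> Ss ! Suc i)"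

text \<open>
  A deterministic online algorithm with advice is given by its next action as a function of what
  has been revealed so far and of the list of all advice bits read so far. No separate internal
  state is needed: since the algorithm is deterministic, its earlier actions, and hence its state,
  can be reconstructed from these two arguments. No computability is required, and the algorithm
  may read forever on some tapes.
\<close>

type_synonym tape = "nat \<Rightarrow> bool"

datatype 'v action = Read_Bit | Output "'v set set"

type_synonym 'v online_alg = "'v inst \<Rightarrow> bool list \<Rightarrow> 'v action"

text \<open>
  \<open>answers A \<phi> P c c' S\<close>: having read \<open>c\<close> bits of \<open>\<phi>\<close> and being shown \<open>P\<close>, algorithm \<open>A\<close> reads on
  until it has read \<open>c'\<close> bits in total, and then outputs \<open>S\<close>.
\<close>

inductive answers :: "'v online_alg \<Rightarrow> tape \<Rightarrow> 'v inst \<Rightarrow> nat \<Rightarrow> nat \<Rightarrow> 'v set set \<Rightarrow> bool"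
  for A \<phi> P where
  out: "A P (map \<phi> [0..<c]) = Output S \<Longrightarrow> answers A \<phi> P c c S"
| read: "A P (map \<phi> [0..<c]) = Read_Bit \<Longrightarrow> answers A \<phi> P (Suc c) c' S \<Longrightarrow> answers A \<phi> P c c' S"

text \<open>
  \<open>steps A \<phi> I c Ss\<close>: in its first \<open>length Ss\<close> steps on \<open>I\<close>, algorithm \<open>A\<close> produces the outputs \<open>Ss\<close>
  and reads \<open>c\<close> bits of \<open>\<phi>\<close> altogether.
\<close>

inductive steps :: "'v online_alg \<Rightarrow> tape \<Rightarrow> 'v inst \<Rightarrow> nat \<Rightarrow> 'v set set list \<Rightarrow> bool"
  for A \<phi> I where
  start: "steps A \<phi> I 0 []"
| step: "steps A \<phi> I c Ss \<Longrightarrow> length Ss < length (snd I) \<Longrightarrow>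
    answers A \<phi> (revealed I (Suc (length Ss))) c c' S \<Longrightarrow> steps A \<phi> I c' (Ss @ [S])"

definition run :: "'v online_alg \<Rightarrow> tape \<Rightarrow> 'v inst \<Rightarrow> nat \<Rightarrow> 'v set set list \<Rightarrow> bool" where
  "run A \<phi> I c Ss \<longleftrightarrow> steps A \<phi> I c Ss \<and> length Ss = length (snd I)"

lemma answers_deterministic:
  "answers A \<phi> P c c\<^sub>1 S\<^sub>1 \<Longrightarrow> answers A \<phi> P c c\<^sub>2 S\<^sub>2 \<Longrightarrow> c\<^sub>1 = c\<^sub>2 \<and> S\<^sub>1 = S\<^sub>2"
  by (induction rule: answers.induct) (erule answers.cases; simp)+

lemma steps_deterministic:
  "steps A \<phi> I c\<^sub>1 Ss\<^sub>1 \<Longrightarrow> steps A \<phi> I c\<^sub>2 Ss\<^sub>2 \<Longrightarrow> length Ss\<^sub>1 = length Ss\<^sub>2 \<Longrightarrow> c\<^sub>1 = c\<^sub>2 \<and> Ss\<^sub>1 = Ss\<^sub>2"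
proof (induction arbitrary: c\<^sub>2 Ss\<^sub>2 rule: steps.induct)
  case start
  from start.prems(1) show ?case
    using start.prems(2) by cases simp_all
next
  case (step c Ss c' S)
  from step.prems(1) show ?case
  proof cases
    case start
    then show ?thesis using step.prems(2) by simp
  next
    case (step d Ts T)
    then have "c = d \<and> Ss = Ts"
      using step.IH step.prems(2) \<open>steps A \<phi> I d Ts\<close> by simp
    then show ?thesis
      using answers_deterministic step.hyps(3) step(4) step(1) by metis
  qed
qed

lemma run_deterministic:
  "run A \<phi> I c\<^sub>1 Ss\<^sub>1 \<Longrightarrow> run A \<phi> I c\<^sub>2 Ss\<^sub>2 \<Longrightarrow> c\<^sub>1 = c\<^sub>2 \<and> Ss\<^sub>1 = Ss\<^sub>2"
  using steps_deterministic unfolding run_def by metis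

text \<open>The list of outputs is nonempty, since graphs have at least one vertex.\<close>

definition solves_optimally :: "'h graph \<Rightarrow> 'v online_alg \<Rightarrow> tape \<Rightarrow> 'v inst \<Rightarrow> bool" where
  "solves_optimally H A \<phi> I \<longleftrightarrow>
     (\<exists>c Ss. run A \<phi> I c Ss \<and> solution H I Ss \<and> card (last Ss) = opt H (fst I))"

definition optimal_alg :: "'h graph \<Rightarrow> 'v online_alg \<Rightarrow> bool" where
  "optimal_alg H A \<longleftrightarrow> (\<forall>I. is_inst I \<longrightarrow> (\<exists>\<phi>. solves_optimally H A \<phi> I))"

end

theory Submission
  imports Defs "HOL-Library.FuncSet" "HOL-Library.Nat_Bijection"
begin

text \<open>
  The adversary first reveals \<open>k\<close> copies of \<open>H\<close>. To force the deletion of an edge \<open>uv\<close> of one of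
  them, it then glues a second copy of \<open>H\<close> along \<open>uv\<close>, with \<open>u\<close> and \<open>v\<close> exchanged. The unique
  optimal solution consists of the \<open>k\<close> shared edges, and since each copy of \<open>H\<close> in the prefix must
  be hit, all of them are deleted as soon as the prefix is complete. Hence for each of the
  \<open>\<parallel>H\<parallel>\<^sup>k\<close> choices of shared edges a different advice string must have been read.

  The point is that deleting the shared edges leaves no copy of \<open>H\<close>. If \<open>H\<close> is connected, the
  gadgets are disjoint, and the exchange of \<open>u\<close> and \<open>v\<close> makes this work. If \<open>H\<close> is
  disconnected, then different gadgets are completely joined, and so are the two sides of each
  gadget outside \<open>{u, v}\<close>. A copy of \<open>H\<close> meeting both sides of such a join has a component inside
  \<open>{u, v}\<close>, which is impossible, because \<open>H\<close> has no isolated vertices and \<open>uv\<close> has been deleted.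
\<close>

section \<open>Connected sets, and two copies of a connected graph glued along a flipped
  edge\<close>

text \<open>This is connectedness by closed sets instead of paths. Only edges inside
  \<open>V\<close> count, so \<open>connected_on E U\<close> speaks of the subgraph induced by
  \<open>U\<close> while \<open>E\<close> stays fixed.\<close>

definition connected_on :: "'a set set \<Rightarrow> 'a set \<Rightarrow> bool" where
  "connected_on E V \<longleftrightarrow>
     (\<forall>Z\<subseteq>V. Z \<noteq> {} \<longrightarrow> (\<forall>e\<in>E. e \<subseteq> V \<longrightarrow> e \<inter> Z \<noteq> {} \<longrightarrow> e \<subseteq> Z) \<longrightarrow> Z = V)"

lemma connected_onD:
  assumes "connected_on E V" "Z \<subseteq> V" "Z \<noteq> {}"
    and "\<And>e. e \<in> E \<Longrightarrow> e \<subseteq> V \<Longrightarrow> e \<inter> Z \<noteq> {} \<Longrightarrow> e \<subseteq> Z"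
  shows "Z = V"
  using assms(1)[unfolded connected_on_def, rule_format, OF assms(2,3)] assms(4) by simp

lemma closed_complement:
  assumes "\<And>e. e \<in> E \<Longrightarrow> e \<subseteq> V \<Longrightarrow> e \<inter> Z \<noteq> {} \<Longrightarrow> e \<subseteq> Z"
    and "e \<in> E" "e \<subseteq> V" "e \<inter> (V - Z) \<noteq> {}"
  shows "e \<subseteq> V - Z"
  using assms by blast

text \<open>
  Here \<open>s\<close> and \<open>t\<close> embed two copies of \<open>H - uv\<close>, glued by \<open>s u = t v\<close> and \<open>s v = t u\<close>, and \<open>\<phi>\<close>
  would embed \<open>H\<close> (not necessarily as an induced subgraph) into their union. Call a connected set
  \<open>U\<close> containing \<open>u\<close> and \<open>v\<close> stable if it contains the traces \<open>Z\<^sub>1 U\<close>, \<open>Z\<^sub>2 U\<close> of \<open>\<phi> ` U\<close> on the two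
  copies. If \<open>U\<close> is minimal, then the traces cover \<open>U\<close>, so by counting vertices they share no
  edge of \<open>H - uv\<close>. Together they would contain as many edges as \<open>U\<close>, but \<open>uv\<close> is missing.
\<close>

lemma flip_gluing_contains_no_copy:
  fixes V :: "'a set" and E :: "'a set set" and s t \<phi> :: "'a \<Rightarrow> 'b"
  assumes fin: "finite V"
    and E2: "\<And>e. e \<in> E \<Longrightarrow> e \<subseteq> V \<and> card e = 2"
    and uvE: "{u, v} \<in> E"
    and conn: "connected_on E V"
    and injs: "inj_on s V" and injt: "inj_on t V"
    and su: "s u = t v" and sv: "s v = t u"
    and overlap: "\<And>x y. x \<in> V \<Longrightarrow> y \<in> V \<Longrightarrow> s x = t y \<Longrightarrow> x = u \<and> y = v \<or> x = v \<and> y = u"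
    and inj\<phi>: "inj_on \<phi> V"
    and range: "\<phi> ` V \<subseteq> s ` V \<union> t ` V"
    and edge: "\<And>a b. {a, b} \<in> E \<Longrightarrow> \<exists>x y. {x, y} \<in> E \<and> {x, y} \<noteq> {u, v} \<and>
                 (\<phi> a = s x \<and> \<phi> b = s y \<or> \<phi> a = t x \<and> \<phi> b = t y)"
  shows False
proof -
  have uV: "u \<in> V" and vV: "v \<in> V" and uv: "u \<noteq> v"
    using E2[OF uvE] by (auto simp: card_2_iff doubleton_eq_iff)
  have inV: "x \<in> V" "y \<in> V" "x \<noteq> y" if "{x, y} \<in> E" for x y
    using E2[OF that] by (auto simp: card_2_iff doubleton_eq_iff)
  define Z\<^sub>1 where "Z\<^sub>1 = (\<lambda>U. {x \<in> V. s x \<in> \<phi> ` U})"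
  define Z\<^sub>2 where "Z\<^sub>2 = (\<lambda>U. {x \<in> V. t x \<in> \<phi> ` U})"
  define stable where "stable = (\<lambda>U. U \<subseteq> V \<and> u \<in> U \<and> v \<in> U \<and> connected_on E U \<and> Z\<^sub>1 U \<union> Z\<^sub>2 U \<subseteq> U)"
  have "stable V"
    unfolding stable_def Z\<^sub>1_def Z\<^sub>2_def using uV vV conn by auto
  then obtain U where U: "stable U" and min: "\<And>U'. stable U' \<Longrightarrow> card U \<le> card U'"
    using ex_has_least_nat[of stable V card] by metis
  have UV: "U \<subseteq> V" and uU: "u \<in> U" and vU: "v \<in> U" and connU: "connected_on E U"
    and Z1U: "Z\<^sub>1 U \<subseteq> U" and Z2U: "Z\<^sub>2 U \<subseteq> U"
    using U unfolding stable_def by auto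
  have finU: "finite U" using UV fin finite_subset by blast
  have injU: "inj_on \<phi> U" using inj\<phi> UV inj_on_subset by blast
  have injs1: "inj_on s (Z\<^sub>1 U)" using injs unfolding Z\<^sub>1_def inj_on_def by auto
  have injt2: "inj_on t (Z\<^sub>2 U)" using injt unfolding Z\<^sub>2_def inj_on_def by auto
  have sZ: "s ` Z\<^sub>1 U = s ` V \<inter> \<phi> ` U" and tZ: "t ` Z\<^sub>2 U = t ` V \<inter> \<phi> ` U"
    unfolding Z\<^sub>1_def Z\<^sub>2_def by blast+
  have img: "s ` Z\<^sub>1 U \<union> t ` Z\<^sub>2 U = \<phi> ` U"
    unfolding sZ tZ using range image_mono[OF UV, of \<phi>] by blast
  have finZ: "finite (Z\<^sub>1 U)" "finite (Z\<^sub>2 U)"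
    unfolding Z\<^sub>1_def Z\<^sub>2_def using fin by auto
  \<comment> \<open>If the image of \<open>U\<close> avoided both glued points, connectedness would
    put it on one side. By counting, the trace on that side would be all of \<open>U\<close>,
    although it misses \<open>u\<close>.\<close>
  have touch: "s u \<in> \<phi> ` U \<or> s v \<in> \<phi> ` U"
  proof (rule ccontr)
    assume no: "\<not> ?thesis"
    define Y where "Y = {w \<in> U. \<phi> w \<in> s ` V}"
    have sides: "s x \<noteq> t y" if "x \<in> V" "y \<in> V" "t y \<in> \<phi> ` U" for x y
      using overlap[of x y] that no su sv by metis
    have closed: "e \<subseteq> Y" if e: "e \<in> E" "e \<subseteq> U" "e \<inter> Y \<noteq> {}" for e
    proof -
      obtain a b where ab: "e = {a, b}" using E2[OF e(1)] by (auto simp: card_2_iff)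
      obtain x y where xy: "{x, y} \<in> E" "\<phi> a = s x \<and> \<phi> b = s y \<or> \<phi> a = t x \<and> \<phi> b = t y"
        using edge e(1) ab by metis
      have "\<phi> a \<in> \<phi> ` U" "\<phi> b \<in> \<phi> ` U" using e(2) ab by auto
      then show ?thesis
        using xy(2) inV[OF xy(1)] sides e(2,3) unfolding ab Y_def by force
    qed
    have one: False if "U = Y"
    proof -
      have "\<phi> ` U \<subseteq> s ` V" using that unfolding Y_def by blast
      then have "\<phi> ` U = s ` Z\<^sub>1 U" unfolding sZ by blast
      then have "card U = card (Z\<^sub>1 U)" using card_image injU injs1 by metis
      moreover have "u \<notin> Z\<^sub>1 U" using no unfolding Z\<^sub>1_def by auto
      ultimately show False using Z1U finU uU card_subset_eq by metis
    qed
    have two: False if "Y = {}"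
    proof -
      have "\<phi> ` U \<inter> s ` V = {}" using that unfolding Y_def by blast
      then have "\<phi> ` U = t ` Z\<^sub>2 U" using img unfolding sZ by blast
      then have "card U = card (Z\<^sub>2 U)" using card_image injU injt2 by metis
      moreover have "u \<notin> Z\<^sub>2 U" using no sv unfolding Z\<^sub>2_def by auto
      ultimately show False using Z2U finU uU card_subset_eq by metis
    qed
    show False using connected_onD[OF connU, of Y] closed one two unfolding Y_def by blast
  qed
  \<comment> \<open>Once \<open>U'\<close> is stable, minimality forces \<open>U' = U\<close>.
    Stability requires \<open>u\<close> and \<open>v\<close>, so they are added by hand; later they
    turn out to lie in the traces anyway.\<close>
  define U' where "U' = Z\<^sub>1 U \<union> Z\<^sub>2 U \<union> {u, v}"
  have U'U: "U' \<subseteq> U" unfolding U'_def using Z1U Z2U uU vU by auto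
  have "connected_on E U'"
    unfolding connected_on_def
  proof (intro allI impI, rule ccontr)
    fix Z assume Z: "Z \<subseteq> U'" "Z \<noteq> {}" "\<forall>e\<in>E. e \<subseteq> U' \<longrightarrow> e \<inter> Z \<noteq> {} \<longrightarrow> e \<subseteq> Z" "Z \<noteq> U'"
    \<comment> \<open>Both parts of the separation are closed, so the one without \<open>u\<close>
      may be taken; because of the edge \<open>uv\<close> it misses \<open>v\<close> as
      well.\<close>
    define Y where "Y = (if u \<in> Z then U' - Z else Z)"
    have Y: "Y \<subseteq> U'" "Y \<noteq> {}" using Z unfolding Y_def by auto
    have Yc: "e \<subseteq> Y" if "e \<in> E" "e \<subseteq> U'" "e \<inter> Y \<noteq> {}" for e
      using closed_complement[of E U' Z e] Z(3) that unfolding Y_def by (auto split: if_splits)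
    have uY: "u \<notin> Y" unfolding Y_def by auto
    have vY: "v \<notin> Y" using Yc[OF uvE] uY unfolding U'_def by auto
    \<comment> \<open>The part of \<open>U\<close> that is sent to \<open>Y\<close> is closed, hence
      all of \<open>U\<close>; but by \<open>touch\<close> some vertex of \<open>U\<close> is sent
      to a glued point, which \<open>Y\<close> does not reach.\<close>
    define X where "X = {w \<in> U. \<phi> w \<in> s ` Y \<union> t ` Y}"
    have YV: "Y \<subseteq> V" using Y(1) U'U UV by auto
    have "X = U"
    proof (rule connected_onD[OF connU])
      show "X \<subseteq> U" unfolding X_def by auto
      obtain y where y: "y \<in> Y" using Y by auto
      then have "y \<in> Z\<^sub>1 U \<union> Z\<^sub>2 U" using Y(1) uY vY unfolding U'_def by auto
      then obtain w where "w \<in> U" "\<phi> w = s y \<or> \<phi> w = t y"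
        unfolding Z\<^sub>1_def Z\<^sub>2_def by force
      then show "X \<noteq> {}" using y unfolding X_def by blast
      fix e assume e: "e \<in> E" "e \<subseteq> U" "e \<inter> X \<noteq> {}"
      then obtain a b where ab: "e = {a, b}" "a \<in> X"
        using E2[OF e(1)] by (auto simp: card_2_iff)
      obtain x y where xy: "{x, y} \<in> E" "\<phi> a = s x \<and> \<phi> b = s y \<or> \<phi> a = t x \<and> \<phi> b = t y"
        using edge e(1) ab by metis
      have "\<phi> a \<in> \<phi> ` U" "\<phi> b \<in> \<phi> ` U" using e(2) ab by auto
      then have xyU': "{x, y} \<subseteq> U'"
        using xy(2) inV[OF xy(1)] unfolding U'_def Z\<^sub>1_def Z\<^sub>2_def by auto
      obtain x' where x': "x' \<in> Y" "\<phi> a = s x' \<or> \<phi> a = t x'" using ab(2) unfolding X_def by auto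
      have "x' \<in> V" "x' \<noteq> u" "x' \<noteq> v" using x'(1) YV uY vY by auto
      then have "x = x'"
        using x'(2) xy(2) overlap[of x' x] overlap[of x x'] inV[OF xy(1)]
          inj_onD[OF injs, of x x'] inj_onD[OF injt, of x x'] by auto
      then have "y \<in> Y" using Yc[OF xy(1) xyU'] x'(1) by auto
      then show "e \<subseteq> X" using xy(2) ab e(2) unfolding X_def by auto
    qed
    moreover obtain w where w: "w \<in> U" "\<phi> w = s u \<or> \<phi> w = s v"
      using touch by (metis imageE)
    ultimately have "w \<in> X" by simp
    then obtain y where y: "y \<in> Y" "\<phi> w = s y \<or> \<phi> w = t y" unfolding X_def by blast
    have "y \<in> V" using y(1) YV by auto
    then have "y = u \<or> y = v"
      using y(2) w(2) overlap[OF uV, of y] overlap[OF vV, of y] inj_onD[OF injs, of y u] inj_onD[OF injs, of y v]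
        uV vV by metis
    then show False using y(1) uY vY by auto
  qed
  moreover have "Z\<^sub>1 U' \<union> Z\<^sub>2 U' \<subseteq> Z\<^sub>1 U \<union> Z\<^sub>2 U"
    using U'U unfolding Z\<^sub>1_def Z\<^sub>2_def by blast
  ultimately have "stable U'" unfolding stable_def using U'U UV unfolding U'_def by blast
  then have "U' = U" using min U'U finU card_seteq by blast
  \<comment> \<open>One glued point in the image of \<open>U\<close> suffices: it has
    \<open>u\<close> as preimage on one side and \<open>v\<close> on the other.\<close>
  moreover have "u \<in> Z\<^sub>1 U \<union> Z\<^sub>2 U" "v \<in> Z\<^sub>1 U \<union> Z\<^sub>2 U"
    using touch su sv uV vV unfolding Z\<^sub>1_def Z\<^sub>2_def by auto
  ultimately have cover: "Z\<^sub>1 U \<union> Z\<^sub>2 U = U" unfolding U'_def by auto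
  \<comment> \<open>Counting once through the image and once through the cover of \<open>U\<close>
    by its traces shows that the traces share as many vertices as the image of \<open>U\<close> has
    glued points.\<close>
  define T where "T = s ` Z\<^sub>1 U \<inter> t ` Z\<^sub>2 U"
  have "card (Z\<^sub>1 U) + card (Z\<^sub>2 U) = card (\<phi> ` U) + card T"
    unfolding T_def img[symmetric] using card_Un_Int[of "s ` Z\<^sub>1 U" "t ` Z\<^sub>2 U"] finZ
      card_image[OF injs1] card_image[OF injt2] by simp
  moreover have "card (Z\<^sub>1 U) + card (Z\<^sub>2 U) = card U + card (Z\<^sub>1 U \<inter> Z\<^sub>2 U)"
    using card_Un_Int[OF finZ] cover by simp
  ultimately have cardT: "card (Z\<^sub>1 U \<inter> Z\<^sub>2 U) = card T"
    using card_image[OF injU] by simp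
  have Tsub: "T \<subseteq> {s u, s v}"
    unfolding T_def Z\<^sub>1_def Z\<^sub>2_def using overlap by blast
  define E\<^sub>R where "E\<^sub>R = (\<lambda>Z. {e \<in> E. e \<noteq> {u, v} \<and> e \<subseteq> Z})"
  have finE: "finite E" using finite_subset[of E "Pow V"] E2 fin by auto
  have finER: "finite (E\<^sub>R Z)" for Z unfolding E\<^sub>R_def using finE by auto
  \<comment> \<open>A common edge needs two common vertices, so both glued points are hit. Then
    \<open>u\<close> and \<open>v\<close> are the only common vertices and the edge is
    \<open>uv\<close>, which \<open>E\<^sub>R\<close> excludes.\<close>
  have "E\<^sub>R (Z\<^sub>1 U \<inter> Z\<^sub>2 U) = {}"
  proof (rule ccontr)
    assume "E\<^sub>R (Z\<^sub>1 U \<inter> Z\<^sub>2 U) \<noteq> {}"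
    then obtain e where e: "e \<in> E" "e \<noteq> {u, v}" "e \<subseteq> Z\<^sub>1 U \<inter> Z\<^sub>2 U" unfolding E\<^sub>R_def by auto
    have "card T \<ge> 2" using card_mono[OF _ e(3)] finZ E2[OF e(1)] cardT by auto
    then have T: "T = {s u, s v}" using Tsub card_seteq[OF _ Tsub] by (simp add: card_insert_if)
    have "s u \<noteq> s v" using inj_onD[OF injs, of u v] uV vV uv by auto
    then have "card T = 2" unfolding T by simp
    then have "e = Z\<^sub>1 U \<inter> Z\<^sub>2 U" using card_seteq[OF _ e(3)] finZ E2[OF e(1)] cardT by auto
    moreover have "s u \<in> \<phi> ` U" "s v \<in> \<phi> ` U" using T img unfolding T_def by auto
    then have "{u, v} \<subseteq> Z\<^sub>1 U \<inter> Z\<^sub>2 U" unfolding Z\<^sub>1_def Z\<^sub>2_def using su sv uV vV by auto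
    ultimately have "{u, v} \<subseteq> e" by simp
    then show False using e(2) card_subset_eq[of e "{u, v}"] E2[OF e(1)] uv
      by (simp add: card_ge_0_finite)
  qed
  then have disj: "E\<^sub>R (Z\<^sub>1 U) \<inter> E\<^sub>R (Z\<^sub>2 U) = {}" unfolding E\<^sub>R_def by auto
  define E\<^sub>U where "E\<^sub>U = {e \<in> E. e \<subseteq> U}"
  have "E\<^sub>R (Z\<^sub>1 U) \<union> E\<^sub>R (Z\<^sub>2 U) \<subseteq> E\<^sub>U - {{u, v}}"
    unfolding E\<^sub>R_def E\<^sub>U_def using cover by auto
  moreover have finEU: "finite E\<^sub>U" unfolding E\<^sub>U_def using finE by auto
  ultimately have "card (E\<^sub>R (Z\<^sub>1 U) \<union> E\<^sub>R (Z\<^sub>2 U)) \<le> card (E\<^sub>U - {{u, v}})"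
    by (intro card_mono) auto
  moreover have "card (E\<^sub>U - {{u, v}}) < card E\<^sub>U"
    using finEU uvE uU vU unfolding E\<^sub>U_def by (intro card_Diff1_less) auto
  ultimately have small: "card (E\<^sub>R (Z\<^sub>1 U)) + card (E\<^sub>R (Z\<^sub>2 U)) < card E\<^sub>U"
    using card_Un_disjoint[OF finER finER disj] by simp
  \<comment> \<open>By \<open>edge\<close>, each edge inside \<open>U\<close> lands on an edge other
    than \<open>uv\<close> of one side, with both ends in the trace on that side. By injectivity,
    \<open>U\<close> has too many edges for this.\<close>
  have "image \<phi> ` E\<^sub>U \<subseteq> image s ` E\<^sub>R (Z\<^sub>1 U) \<union> image t ` E\<^sub>R (Z\<^sub>2 U)"
  proof
    fix d assume "d \<in> image \<phi> ` E\<^sub>U"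
    then obtain e where e: "e \<in> E" "e \<subseteq> U" "d = \<phi> ` e" unfolding E\<^sub>U_def by auto
    obtain a b where ab: "e = {a, b}" using E2[OF e(1)] by (auto simp: card_2_iff)
    obtain x y where xy: "{x, y} \<in> E" "{x, y} \<noteq> {u, v}" "\<phi> a = s x \<and> \<phi> b = s y \<or> \<phi> a = t x \<and> \<phi> b = t y"
      using edge e(1) ab by metis
    have ph: "\<phi> a \<in> \<phi> ` U" "\<phi> b \<in> \<phi> ` U" using e(2) ab by auto
    from xy(3) show "d \<in> image s ` E\<^sub>R (Z\<^sub>1 U) \<union> image t ` E\<^sub>R (Z\<^sub>2 U)"
    proof
      assume h: "\<phi> a = s x \<and> \<phi> b = s y"
      then have "{x, y} \<in> E\<^sub>R (Z\<^sub>1 U)" using xy ph inV[OF xy(1)] unfolding E\<^sub>R_def Z\<^sub>1_def by auto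
      moreover have "d = s ` {x, y}" using h e(3) ab by auto
      ultimately show ?thesis by blast
    next
      assume h: "\<phi> a = t x \<and> \<phi> b = t y"
      then have "{x, y} \<in> E\<^sub>R (Z\<^sub>2 U)" using xy ph inV[OF xy(1)] unfolding E\<^sub>R_def Z\<^sub>2_def by auto
      moreover have "d = t ` {x, y}" using h e(3) ab by auto
      ultimately show ?thesis by blast
    qed
  qed
  then have "card (image \<phi> ` E\<^sub>U) \<le> card (image s ` E\<^sub>R (Z\<^sub>1 U) \<union> image t ` E\<^sub>R (Z\<^sub>2 U))"
    using finER by (intro card_mono) auto
  also have "\<dots> \<le> card (E\<^sub>R (Z\<^sub>1 U)) + card (E\<^sub>R (Z\<^sub>2 U))"
    by (meson add_mono card_Un_le card_image_le finER le_trans)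
  finally have "card (image \<phi> ` E\<^sub>U) < card E\<^sub>U" using small by simp
  moreover have "inj_on (image \<phi>) E\<^sub>U"
    using inj_on_image_Pow[OF injU] unfolding E\<^sub>U_def by (rule inj_on_subset) auto
  ultimately show False using card_image[of "image \<phi>" E\<^sub>U] by simp
qed

section \<open>Embeddings of \<open>H\<close> and deletion sets\<close>

lemma not_H_free:
  assumes "inj_on \<phi> (verts H)" "\<phi> ` verts H \<subseteq> verts G"
    and "\<And>x y. x \<in> verts H \<Longrightarrow> y \<in> verts H \<Longrightarrow> {x, y} \<in> edges H \<longleftrightarrow> {\<phi> x, \<phi> y} \<in> edges G"
  shows "\<not> H_free H G"
proof -
  have "isomorphic H (induced G (\<phi> ` verts H))"
    unfolding isomorphic_def induced_def using assms(1,3)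
    by (intro exI[of _ \<phi>]) (auto intro: inj_on_imp_bij_betw)
  then show ?thesis unfolding H_free_def using assms(2) by blast
qed

text \<open>Deletion adds no edges, so an induced copy that loses no edge stays induced. All lower
  bounds on deletion sets below come from here.\<close>

lemma H_free_hits_copy:
  assumes H: "simple_graph H"
    and "inj_on \<phi> (verts H)" "\<phi> ` verts H \<subseteq> verts G"
    and "\<And>x y. x \<in> verts H \<Longrightarrow> y \<in> verts H \<Longrightarrow> {x, y} \<in> edges H \<longleftrightarrow> {\<phi> x, \<phi> y} \<in> edges G"
    and "H_free H (delete_edges G S)"
  shows "S \<inter> image \<phi> ` edges H \<noteq> {}"
proof
  assume disj: "S \<inter> image \<phi> ` edges H = {}"
  have "\<not> H_free H (delete_edges G S)"
  proof (rule not_H_free[OF assms(2)])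
    show "\<phi> ` verts H \<subseteq> verts (delete_edges G S)" using assms(3) by (simp add: delete_edges_def)
    fix x y assume xy: "x \<in> verts H" "y \<in> verts H"
    have "{\<phi> x, \<phi> y} \<notin> S" if "{x, y} \<in> edges H"
      using disj imageI[OF that, of "image \<phi>"] by auto
    then show "{x, y} \<in> edges H \<longleftrightarrow> {\<phi> x, \<phi> y} \<in> edges (delete_edges G S)"
      using assms(4)[OF xy] by (auto simp: delete_edges_def)
  qed
  then show False using assms(5) by simp
qed

lemma not_H_freeE:
  assumes "\<not> H_free H G"
  obtains f where "inj_on f (verts H)" "f ` verts H \<subseteq> verts G"
    and "\<And>x y. x \<in> verts H \<Longrightarrow> y \<in> verts H \<Longrightarrow> {x, y} \<in> edges H \<longleftrightarrow> {f x, f y} \<in> edges G"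
proof -
  obtain X f where X: "X \<subseteq> verts G" "bij_betw f (verts H) (verts (induced G X))"
    and e: "\<forall>x\<in>verts H. \<forall>y\<in>verts H. {x, y} \<in> edges H \<longleftrightarrow> {f x, f y} \<in> edges (induced G X)"
    using assms unfolding H_free_def isomorphic_def by blast
  have fX: "f ` verts H = X" using X(2) by (simp add: bij_betw_def induced_def)
  show thesis
  proof
    show "inj_on f (verts H)" using X(2) by (simp add: bij_betw_def)
    show "f ` verts H \<subseteq> verts G" using fX X(1) by simp
    show "{x, y} \<in> edges H \<longleftrightarrow> {f x, f y} \<in> edges G" if "x \<in> verts H" "y \<in> verts H" for x y
      using e that fX by (auto simp: induced_def)
  qed
qed

section \<open>The common prefix: \<open>k\<close> numbered copies of \<open>H\<close>\<close>

locale copies =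
  fixes H :: "'h graph" and g :: "'h \<Rightarrow> nat" and k :: nat
  assumes simple: "simple_graph H"
    and no_isolated: "no_isolated_vertices H"
    and inj_g: "inj_on g (verts H)"
begin

abbreviation "V \<equiv> verts H"
abbreviation "E \<equiv> edges H"

text \<open>The algorithm works on natural numbers, so \<open>g\<close> numbers the vertices of
  \<open>H\<close> and a vertex codes a pair of block and number. Even second components leave the
  odd ones for vertices that arrive after the prefix.\<close>

definition orig :: "nat \<Rightarrow> 'h \<Rightarrow> nat" where
  "orig i x = prod_encode (i, 2 * g x)"

definition block :: "nat \<Rightarrow> nat" where
  "block n = fst (prod_decode n)"

definition disconnected :: bool where
  "disconnected \<longleftrightarrow> \<not> connected_on E V"

definition prefix_verts :: "nat set" where
  "prefix_verts = (\<Union>i<k. orig i ` V)"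

text \<open>Fixed before the shared edges are chosen, so that all instances begin with the same
  graph.\<close>

definition prefix :: "nat graph" where
  "prefix = Graph prefix_verts ((\<Union>i<k. image (orig i) ` E) \<union>
     {{a, b} | a b. disconnected \<and> a \<in> prefix_verts \<and> b \<in> prefix_verts \<and> block a \<noteq> block b})"

lemma finV: "finite V" and V_ne: "V \<noteq> {}"
  using simple unfolding simple_graph_def by auto

lemma edgeD: "e \<in> E \<Longrightarrow> e \<subseteq> V \<and> card e = 2"
  using simple unfolding simple_graph_def by auto

lemma finE: "finite E"
  using finite_subset[of E "Pow V"] edgeD finV by auto

lemma edge_pair:
  assumes "{x, y} \<in> E" shows "x \<in> V" "y \<in> V" "x \<noteq> y"
  using edgeD[OF assms] by (auto simp: card_2_iff doubleton_eq_iff)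

lemma edgeE:
  assumes "e \<in> E" obtains x y where "e = {x, y}" "{x, y} \<in> E"
proof -
  obtain x y where "e = {x, y}" using edgeD[OF assms] by (auto simp: card_2_iff)
  then show thesis using that assms by simp
qed

lemma block_orig [simp]: "block (orig i x) = i"
  by (simp add: block_def orig_def)

lemma orig_eq: "x \<in> V \<Longrightarrow> y \<in> V \<Longrightarrow> orig i x = orig j y \<longleftrightarrow> i = j \<and> x = y"
  unfolding orig_def using inj_onD[OF inj_g] by auto

lemma inj_orig: "inj_on (orig i) V"
  by (auto simp: inj_on_def orig_eq)

lemma finite_prefix: "finite prefix_verts"
  unfolding prefix_verts_def using finV by auto

lemma prefix_edge_iff:
  assumes i: "i < k" and x: "x \<in> V" and y: "y \<in> V"
  shows "{x, y} \<in> E \<longleftrightarrow> {orig i x, orig i y} \<in> edges prefix"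
proof
  assume "{x, y} \<in> E"
  then have "orig i ` {x, y} \<in> image (orig i) ` E" by blast
  then show "{orig i x, orig i y} \<in> edges prefix" using i unfolding prefix_def by auto
next
  assume "{orig i x, orig i y} \<in> edges prefix"
  then consider j e where "j < k" "e \<in> E" "{orig i x, orig i y} = orig j ` e"
    | a b where "{orig i x, orig i y} = {a, b}" "block a \<noteq> block b"
    unfolding prefix_def by auto
  then show "{x, y} \<in> E"
  proof cases
    case 1
    then obtain a b where ab: "e = {a, b}" "{a, b} \<in> E" using edgeE by metis
    show ?thesis using 1(3) edge_pair[OF ab(2)] ab x y
      by (auto simp: doubleton_eq_iff orig_eq insert_commute)
  next
    case 2
    then show ?thesis by (auto simp: doubleton_eq_iff)
  qed
qed

end

section \<open>The gadgets that complete the prefix\<close>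

locale gadgets = copies +
  fixes u v :: "nat \<Rightarrow> 'a"
  assumes uvE: "i < k \<Longrightarrow> {u i, v i} \<in> E"
begin

text \<open>Odd codes keep the new vertices apart from the prefix, so the two sides of a block meet
  only in the exchanged ends of the shared edge.\<close>

definition flip :: "nat \<Rightarrow> 'a \<Rightarrow> nat" where
  "flip i x = (if x = u i then orig i (v i) else if x = v i then orig i (u i)
     else prod_encode (i, Suc (2 * g x)))"

text \<open>The second alternative is oriented from the original to the flipped side; this does no
  harm, since only unordered pairs enter the edges of \<open>G\<close>.\<close>

definition cross :: "nat \<Rightarrow> nat \<Rightarrow> bool" where
  "cross a b \<longleftrightarrow> disconnected \<and> (block a \<noteq> block b \<or>
     (\<exists>i<k. \<exists>x\<in>V - {u i, v i}. \<exists>y\<in>V - {u i, v i}. a = orig i x \<and> b = flip i y))"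

definition G :: "nat graph" where
  "G = (let W = \<Union>i<k. orig i ` V \<union> flip i ` V in
     Graph W ((\<Union>i<k. image (orig i) ` E \<union> image (flip i) ` E) \<union>
       {{a, b} | a b. a \<in> W \<and> b \<in> W \<and> cross a b}))"

definition chosen :: "nat set set" where
  "chosen = (\<lambda>i. orig i ` {u i, v i}) ` {..<k}"

lemma verts_G: "verts G = (\<Union>i<k. orig i ` V \<union> flip i ` V)"
  by (simp add: G_def Let_def)

lemma edges_G: "edges G = (\<Union>i<k. image (orig i) ` E \<union> image (flip i) ` E) \<union>
    {{a, b} | a b. a \<in> verts G \<and> b \<in> verts G \<and> cross a b}"
  by (simp add: G_def Let_def)

lemma uv:
  assumes "i < k" shows "u i \<in> V" "v i \<in> V" "u i \<noteq> v i"
  using edge_pair[OF uvE[OF assms]] by auto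

lemma block_flip [simp]: "block (flip i x) = i"
  unfolding flip_def by (auto simp: block_def orig_def)

lemma flip_u: "flip i (u i) = orig i (v i)"
  by (simp add: flip_def)

lemma flip_v: "i < k \<Longrightarrow> flip i (v i) = orig i (u i)"
  using uv by (auto simp: flip_def)

lemma orig_eq_flip:
  assumes "i < k" "x \<in> V" "y \<in> V"
  shows "orig i x = flip i y \<longleftrightarrow> x = u i \<and> y = v i \<or> x = v i \<and> y = u i"
proof -
  have "orig i x \<noteq> prod_encode (i, Suc (2 * g y))"
    unfolding orig_def by simp presburger
  then show ?thesis using uv[OF assms(1)] assms by (auto simp: flip_def orig_eq)
qed

lemma flip_eq:
  assumes "i < k" "x \<in> V" "y \<in> V"
  shows "flip i x = flip i y \<longleftrightarrow> x = y"
proof -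
  have "orig i z \<noteq> prod_encode (i, Suc (2 * g w))" for z w
    unfolding orig_def by simp presburger
  then show ?thesis
    using uv[OF assms(1)] assms inj_onD[OF inj_g, of x y] unfolding flip_def
    by (auto simp: orig_eq dest: not_sym)
qed

lemma inj_flip: "i < k \<Longrightarrow> inj_on (flip i) V"
  by (auto simp: inj_on_def flip_eq)

lemma in_block:
  assumes "a \<in> verts G" "block a = i"
  shows "i < k" "a \<in> orig i ` V \<union> flip i ` V"
  using assms unfolding verts_G by auto

lemma edge_cases:
  assumes "d \<in> edges G"
  obtains (orig) i x y where "i < k" "{x, y} \<in> E" "d = {orig i x, orig i y}"
    | (flip) i x y where "i < k" "{x, y} \<in> E" "d = {flip i x, flip i y}"
    | (cross) a b where "a \<in> verts G" "b \<in> verts G" "cross a b" "d = {a, b}"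
proof -
  from assms consider i e where "i < k" "e \<in> E" "d = orig i ` e"
    | i e where "i < k" "e \<in> E" "d = flip i ` e"
    | a b where "a \<in> verts G" "b \<in> verts G" "cross a b" "d = {a, b}"
    unfolding edges_G by auto
  then show thesis
  proof cases
    case 1
    obtain x y where "e = {x, y}" "{x, y} \<in> E" by (rule edgeE[OF 1(2)])
    then show ?thesis using orig[OF 1(1), of x y] 1(3) by simp
  next
    case 2
    obtain x y where "e = {x, y}" "{x, y} \<in> E" by (rule edgeE[OF 2(2)])
    then show ?thesis using flip[OF 2(1), of x y] 2(3) by simp
  next
    case 3
    then show ?thesis using cross by blast
  qed
qed

text \<open>Inside a block, a cross pair has one end found only on the original side and one found
  only on the flipped side. So joins add no edge within a side, and both sides stay induced copies
  of \<open>H\<close>.\<close>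

lemma crossD:
  assumes "cross a b" "block a = i" "block b = i" "x \<in> V" "y \<in> V"
  shows "{a, b} \<noteq> {orig i x, orig i y}" and "{a, b} \<noteq> {flip i x, flip i y}"
proof -
  have "\<exists>j<k. \<exists>p\<in>V - {u j, v j}. \<exists>q\<in>V - {u j, v j}. a = orig j p \<and> b = flip j q"
    using assms(1-3) unfolding cross_def by simp
  then obtain j p q where j: "j < k" "p \<in> V - {u j, v j}" "q \<in> V - {u j, v j}" "a = orig j p" "b = flip j q"
    by blast
  then have pq: "i < k" "p \<in> V - {u i, v i}" "q \<in> V - {u i, v i}" "a = orig i p" "b = flip i q"
    using assms(2) by auto
  have "orig i z \<noteq> b" "flip i z \<noteq> a" if "z \<in> V" for z
    using pq that orig_eq_flip[of i z q] orig_eq_flip[of i p z] by auto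
  then show "{a, b} \<noteq> {orig i x, orig i y}" "{a, b} \<noteq> {flip i x, flip i y}"
    using assms(4,5) by (metis doubleton_eq_iff)+
qed

lemma orig_edge_iff:
  assumes i: "i < k" and x: "x \<in> V" and y: "y \<in> V"
  shows "{x, y} \<in> E \<longleftrightarrow> {orig i x, orig i y} \<in> edges G"
proof
  assume "{x, y} \<in> E"
  then have "orig i ` {x, y} \<in> image (orig i) ` E" by blast
  then show "{orig i x, orig i y} \<in> edges G" using i unfolding edges_G by auto
next
  assume "{orig i x, orig i y} \<in> edges G"
  then show "{x, y} \<in> E"
  proof (cases rule: edge_cases)
    case (orig j a b)
    then show ?thesis using edge_pair[OF orig(2)] x y
      by (auto simp: doubleton_eq_iff orig_eq insert_commute)
  next
    \<comment> \<open>An edge of the flipped side between original vertices can only be the shared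
      edge, which is an edge of \<open>H\<close> on both sides.\<close>
    case (flip j a b)
    \<comment> \<open>Applying \<open>block\<close> to both sides of the equation of edges compares
      their block numbers; this device recurs below.\<close>
    moreover have "j = i" using arg_cong[OF flip(3), of "image block"] by simp
    ultimately show ?thesis using edge_pair[OF flip(2)] x y uvE[OF i]
      by (auto simp: doubleton_eq_iff orig_eq_flip insert_commute)
  next
    case (cross a b)
    moreover have "block a = i" "block b = i" using arg_cong[OF cross(4), of "image block"] by auto
    ultimately show ?thesis using crossD(1)[of a b i x y] x y by auto
  qed
qed

lemma flip_edge_iff:
  assumes i: "i < k" and x: "x \<in> V" and y: "y \<in> V"
  shows "{x, y} \<in> E \<longleftrightarrow> {flip i x, flip i y} \<in> edges G"
proof
  assume "{x, y} \<in> E"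
  then have "flip i ` {x, y} \<in> image (flip i) ` E" by blast
  then show "{flip i x, flip i y} \<in> edges G" using i unfolding edges_G by auto
next
  assume "{flip i x, flip i y} \<in> edges G"
  then show "{x, y} \<in> E"
  proof (cases rule: edge_cases)
    case (orig j a b)
    moreover have "j = i" using arg_cong[OF orig(3), of "image block"] by simp
    ultimately have "{orig i a, orig i b} = {flip i x, flip i y}" by simp
    then have "{x, y} = {u i, v i}"
      using orig(2) edge_pair[OF orig(2)] x y i
      by (auto simp: doubleton_eq_iff orig_eq_flip)
    then show ?thesis using uvE[OF i] by simp
  next
    case (flip j a b)
    moreover have "j = i" using arg_cong[OF flip(3), of "image block"] by simp
    ultimately show ?thesis using edge_pair[OF flip(2)] x y
      by (auto simp: doubleton_eq_iff flip_eq insert_commute)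
  next
    case (cross a b)
    moreover have "block a = i" "block b = i" using arg_cong[OF cross(4), of "image block"] by auto
    ultimately show ?thesis using crossD(2)[of a b i x y] x y by auto
  qed
qed

lemma chosen_flip: "i < k \<Longrightarrow> flip i ` {u i, v i} = orig i ` {u i, v i}"
  by (auto simp: flip_u flip_v)

lemma chosenI: "i < k \<Longrightarrow> orig i ` {u i, v i} \<in> chosen"
  unfolding chosen_def by blast

lemma not_chosen:
  assumes "block a \<noteq> block b"
  shows "{a, b} \<notin> chosen"
proof
  assume "{a, b} \<in> chosen"
  then obtain i where "{a, b} = orig i ` {u i, v i}" unfolding chosen_def by auto
  from arg_cong[OF this, of "image block"] show False using assms by auto
qed

lemma chosen_sub: "chosen \<subseteq> edges G"
proof
  fix d assume "d \<in> chosen"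
  then obtain i where i: "i < k" "d = {orig i (u i), orig i (v i)}" unfolding chosen_def by auto
  then show "d \<in> edges G" using orig_edge_iff[OF i(1)] uv[OF i(1)] uvE[OF i(1)] by simp
qed

lemma inj_chosen: "inj_on (\<lambda>i. orig i ` {u i, v i}) {..<k}"
proof (rule inj_onI)
  fix i j assume "orig i ` {u i, v i} = orig j ` {u j, v j}"
  from arg_cong[OF this, of "image block"] show "i = j" by simp
qed

lemma card_chosen: "card chosen = k"
  unfolding chosen_def using card_image[OF inj_chosen] by simp

section \<open>Deleting the chosen edges destroys all copies of \<open>H\<close>\<close>

text \<open>Pulled back along \<open>s\<close>, such an \<open>f\<close> would map the edges of
  \<open>H\<close> injectively to edges of \<open>H\<close> other than the chosen one. Both
  \<open>orig i\<close> and \<open>flip i\<close> serve as \<open>s\<close>.\<close>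

lemma no_copy_on_side:
  assumes i: "i < k" and injs: "inj_on s V"
    and s_edge: "\<And>x y. x \<in> V \<Longrightarrow> y \<in> V \<Longrightarrow> {x, y} \<in> E \<longleftrightarrow> {s x, s y} \<in> edges G"
    and s_chosen: "s ` {u i, v i} \<in> chosen"
    and injf: "inj_on f V" and fs: "f ` V \<subseteq> s ` V"
    and f_edge: "\<And>x y. {x, y} \<in> E \<Longrightarrow> {f x, f y} \<in> edges G - chosen"
  shows False
proof -
  define h where "h = inv_into V s \<circ> f"
  have sh: "s (h x) = f x" and hV: "h x \<in> V" if "x \<in> V" for x
    using that fs unfolding h_def by (auto simp: f_inv_into_f inv_into_into image_subset_iff)
  have "inj_on h V" using sh injf unfolding inj_on_def by metis
  then have "inj_on (image h) E"
    using inj_on_image_Pow[of h V] edgeD by (auto intro: inj_on_subset)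
  then have "card E = card (image h ` E)" by (simp add: card_image)
  also have "\<dots> \<le> card (E - {{u i, v i}})"
  proof (rule card_mono)
    show "image h ` E \<subseteq> E - {{u i, v i}}"
    proof
      fix d assume "d \<in> image h ` E"
      then obtain e where e: "e \<in> E" "d = h ` e" by auto
      obtain x y where "e = {x, y}" "{x, y} \<in> E" by (rule edgeE[OF e(1)])
      then have xy: "{x, y} \<in> E" "d = {h x, h y}" using e(2) by auto
      have V: "x \<in> V" "y \<in> V" using edge_pair[OF xy(1)] by auto
      have "{s (h x), s (h y)} \<in> edges G - chosen" using f_edge[OF xy(1)] sh V by simp
      moreover have "s ` d = {s (h x), s (h y)}" using xy(2) by simp
      ultimately have "s ` d \<notin> chosen" and "{h x, h y} \<in> E"
        using s_edge[OF hV hV, of x y] V by auto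
      moreover from this have "d \<noteq> {u i, v i}" using s_chosen by metis
      ultimately show "d \<in> E - {{u i, v i}}" using xy(2) by simp
    qed
  qed (use finE in auto)
  also have "\<dots> < card E" using finE uvE[OF i] by (intro card_Diff1_less) auto
  finally show False by simp
qed

text \<open>A hypothetical induced copy of \<open>H\<close> in \<open>G\<close> without the chosen
  edges, given by an embedding \<open>f\<close>; the results up to \<open>no_copy\<close> refute
  it.\<close>

context
  fixes f :: "'a \<Rightarrow> nat"
  assumes injf: "inj_on f V" and fG: "f ` V \<subseteq> verts G"
    and f_iff: "\<And>x y. x \<in> V \<Longrightarrow> y \<in> V \<Longrightarrow> {x, y} \<in> E \<longleftrightarrow> {f x, f y} \<in> edges G - chosen"
begin

lemma f_edge: "{x, y} \<in> E \<Longrightarrow> {f x, f y} \<in> edges G - chosen"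
  using f_iff edge_pair by blast

text \<open>The copy is induced, so a surviving join between two of its vertices must come from an
  edge of \<open>H\<close>. Joins thus restrict the copy.\<close>

lemma f_cross:
  assumes "x \<in> V" "y \<in> V" "cross (f x) (f y)" "{f x, f y} \<notin> chosen"
  shows "{x, y} \<in> E"
proof -
  have "f x \<in> verts G" "f y \<in> verts G" using assms fG by auto
  then have "{f x, f y} \<in> edges G" using assms(3) unfolding edges_G by blast
  then show ?thesis using f_iff assms by blast
qed

text \<open>With joins, vertices sent to different blocks are adjacent in \<open>H\<close>, so
  images in several blocks would make \<open>H\<close> connected. Without joins, \<open>H\<close> is
  connected and no edge leaves a block.\<close>

lemma f_block:
  assumes xy: "x \<in> V" "y \<in> V"
  shows "block (f x) = block (f y)"
proof (cases disconnected)
  case True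
  show ?thesis
  proof (rule ccontr)
    assume ne: "block (f x) \<noteq> block (f y)"
    have "connected_on E V" unfolding connected_on_def
    proof (intro allI impI, rule ccontr)
      fix Z assume Z: "Z \<subseteq> V" "Z \<noteq> {}" "\<forall>e\<in>E. e \<subseteq> V \<longrightarrow> e \<inter> Z \<noteq> {} \<longrightarrow> e \<subseteq> Z" "Z \<noteq> V"
      have eq: "block (f z) = block (f w)" if "z \<in> Z" "w \<in> V - Z" for z w
      proof (rule ccontr)
        assume "block (f z) \<noteq> block (f w)"
        then have "{z, w} \<in> E"
          using f_cross[of z w] not_chosen True that Z(1) unfolding cross_def by auto
        then show False using Z(1,3) that edgeD by blast
      qed
      obtain z w where zw: "z \<in> Z" "w \<in> V - Z" using Z by auto
      then have "block (f a) = block (f z)" if "a \<in> V" for a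
        using eq[of a w] eq[of z w] eq[of z a] that by (cases "a \<in> Z") auto
      then show False using ne xy by metis
    qed
    then show False using True disconnected_def by simp
  qed
next
  case False
  define Z where "Z = {a \<in> V. block (f a) = block (f x)}"
  have "Z = V"
  proof (rule connected_onD[of E V])
    show "connected_on E V" using False disconnected_def by simp
    show "Z \<subseteq> V" "Z \<noteq> {}" using xy unfolding Z_def by auto
    fix e assume e: "e \<in> E" "e \<subseteq> V" "e \<inter> Z \<noteq> {}"
    obtain a b where ab: "e = {a, b}" "{a, b} \<in> E" using edgeE[OF e(1)] by metis
    have "{f a, f b} \<in> edges G" using f_edge[OF ab(2)] by auto
    then have "block (f a) = block (f b)"
    proof (cases rule: edge_cases)
      case (orig j p q)
      from arg_cong[OF orig(3), of "image block"] show ?thesis by simp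
    next
      case (flip j p q)
      from arg_cong[OF flip(3), of "image block"] show ?thesis by simp
    next
      case (cross p q)
      then show ?thesis using False unfolding cross_def by simp
    qed
    then show "e \<subseteq> Z" using e ab unfolding Z_def by auto
  qed
  then have "y \<in> Z" using xy by simp
  then show ?thesis unfolding Z_def by simp
qed

text \<open>Without joins, every edge of the copy lies on one of the two sides and, not being
  deleted, differs from the shared edge. This is what \<open>flip_gluing_contains_no_copy\<close>
  excludes.\<close>

lemma no_copy_if_connected:
  assumes i: "i < k" and bl: "\<And>x. x \<in> V \<Longrightarrow> block (f x) = i"
    and fV: "f ` V \<subseteq> orig i ` V \<union> flip i ` V" and conn: "\<not> disconnected"
  shows False
proof (rule flip_gluing_contains_no_copy[of V E "u i" "v i" "orig i" "flip i" f])
  show "finite V" by (rule finV)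
  show "\<And>e. e \<in> E \<Longrightarrow> e \<subseteq> V \<and> card e = 2" by (rule edgeD)
  show "{u i, v i} \<in> E" by (rule uvE[OF i])
  show "connected_on E V" using conn disconnected_def by simp
  show "inj_on (orig i) V" "inj_on (flip i) V" "inj_on f V" using inj_orig inj_flip i injf by auto
  show "orig i (u i) = flip i (v i)" "orig i (v i) = flip i (u i)" using flip_u flip_v i by auto
  show "\<And>x y. x \<in> V \<Longrightarrow> y \<in> V \<Longrightarrow> orig i x = flip i y \<Longrightarrow> x = u i \<and> y = v i \<or> x = v i \<and> y = u i"
    using orig_eq_flip[OF i] by simp
  show "f ` V \<subseteq> orig i ` V \<union> flip i ` V" by (rule fV)
  fix a b assume ab: "{a, b} \<in> E"
  then have fab: "{f a, f b} \<in> edges G" "{f a, f b} \<notin> chosen" using f_edge by auto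
  have bb: "block (f a) = i" "block (f b) = i" using bl edge_pair[OF ab] by auto
  from fab(1) show "\<exists>x y. {x, y} \<in> E \<and> {x, y} \<noteq> {u i, v i} \<and>
      (f a = orig i x \<and> f b = orig i y \<or> f a = flip i x \<and> f b = flip i y)"
  proof (cases rule: edge_cases)
    case (orig j x y)
    have "j = i" using arg_cong[OF orig(3), of "image block"] bb by auto
    then have eq: "{f a, f b} = orig i ` {x, y}" using orig(3) by simp
    then have "{x, y} \<noteq> {u i, v i}" using fab(2) chosenI[OF i] by metis
    then have "{x, y} \<in> E \<and> {x, y} \<noteq> {u i, v i}" "{y, x} \<in> E \<and> {y, x} \<noteq> {u i, v i}"
      using orig(2) by (simp_all add: insert_commute)
    moreover have "f a = orig i x \<and> f b = orig i y \<or> f a = orig i y \<and> f b = orig i x"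
      using eq by (simp add: doubleton_eq_iff)
    ultimately show ?thesis by blast
  next
    case (flip j x y)
    have "j = i" using arg_cong[OF flip(3), of "image block"] bb by auto
    then have eq: "{f a, f b} = flip i ` {x, y}" using flip(3) by simp
    then have "{x, y} \<noteq> {u i, v i}" using fab(2) chosenI[OF i] chosen_flip[OF i] by metis
    then have "{x, y} \<in> E \<and> {x, y} \<noteq> {u i, v i}" "{y, x} \<in> E \<and> {y, x} \<noteq> {u i, v i}"
      using flip(2) by (simp_all add: insert_commute)
    moreover have "f a = flip i x \<and> f b = flip i y \<or> f a = flip i y \<and> f b = flip i x"
      using eq by (simp add: doubleton_eq_iff)
    ultimately show ?thesis by blast
  next
    case (cross a b)
    then show ?thesis using conn unfolding cross_def by simp
  qed
qed

text \<open>No copy fits on one side, so it uses vertices private to each side, and these are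
  completely joined. As every component contains such a vertex, \<open>H\<close> would be
  connected.\<close>

lemma no_copy_if_disconnected:
  assumes i: "i < k" and fV: "f ` V \<subseteq> orig i ` V \<union> flip i ` V" and disc: disconnected
  shows False
proof -
  have noside1: "\<not> f ` V \<subseteq> orig i ` V"
    using no_copy_on_side[OF i inj_orig orig_edge_iff[OF i] chosenI[OF i] injf _ f_edge] by blast
  have "flip i ` {u i, v i} \<in> chosen" unfolding chosen_flip[OF i] by (rule chosenI[OF i])
  then have noside2: "\<not> f ` V \<subseteq> flip i ` V"
    using no_copy_on_side[OF i inj_flip[OF i] flip_edge_iff[OF i] _ injf _ f_edge] by blast
  define A where "A = {x \<in> V. f x \<in> orig i ` (V - {u i, v i})}"
  define B where "B = {x \<in> V. f x \<in> flip i ` (V - {u i, v i})}"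
  have uvflip: "orig i (u i) \<in> flip i ` V" "orig i (v i) \<in> flip i ` V"
    "flip i (u i) \<in> orig i ` V" "flip i (v i) \<in> orig i ` V"
    using flip_u flip_v i uv[OF i] by (auto intro: rev_image_eqI)
  have rest: "f x \<in> {orig i (u i), orig i (v i)}" if x: "x \<in> V" "x \<notin> A" "x \<notin> B" for x
  proof -
    obtain z where z: "z \<in> V" "f x = orig i z \<or> f x = flip i z" using fV x(1) by blast
    have "z = u i \<or> z = v i"
    proof (rule ccontr)
      assume "\<not> ?thesis"
      then have "z \<in> V - {u i, v i}" using z(1) by simp
      then show False using z(2) x unfolding A_def B_def by blast
    qed
    then show ?thesis using z(2) flip_u flip_v[OF i] by auto
  qed
  have A: "A \<noteq> {}"
  proof
    assume "A = {}"
    have "f x \<in> flip i ` V" if "x \<in> V" for x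
    proof (cases "x \<in> B")
      case True
      then show ?thesis unfolding B_def by blast
    next
      case False
      then show ?thesis using rest[OF that] \<open>A = {}\<close> uvflip by auto
    qed
    then have "f ` V \<subseteq> flip i ` V" by auto
    then show False using noside2 by simp
  qed
  have B: "B \<noteq> {}"
  proof
    assume "B = {}"
    have "f x \<in> orig i ` V" if "x \<in> V" for x
    proof (cases "x \<in> A")
      case True
      then show ?thesis unfolding A_def by blast
    next
      case False
      then show ?thesis using rest[OF that] \<open>B = {}\<close> uv[OF i] by auto
    qed
    then have "f ` V \<subseteq> orig i ` V" by auto
    then show False using noside1 by simp
  qed
  have AB: "{a, b} \<in> E" if ab: "a \<in> A" "b \<in> B" for a b
  proof (rule f_cross)
    obtain x y where xy: "x \<in> V - {u i, v i}" "f a = orig i x" "y \<in> V - {u i, v i}" "f b = flip i y"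
      using ab unfolding A_def B_def by blast
    show "a \<in> V" "b \<in> V" using ab unfolding A_def B_def by auto
    show c: "cross (f a) (f b)" using xy disc i unfolding cross_def by blast
    show "{f a, f b} \<notin> chosen"
    proof
      assume "{f a, f b} \<in> chosen"
      then obtain j where j: "{f a, f b} = {orig j (u j), orig j (v j)}" unfolding chosen_def by auto
      have "j = i" using arg_cong[OF j, of "image block"] xy by auto
      then show False using crossD(1)[OF c, of i "u i" "v i"] j xy uv[OF i] by auto
    qed
  qed
  \<comment> \<open>A closed set outside \<open>A\<close> and \<open>B\<close> would contain an
    edge, since no vertex is isolated, and \<open>f\<close> would send this edge to the deleted
    shared one.\<close>
  have meets: "Y \<inter> (A \<union> B) \<noteq> {}"
    if Y: "Y \<subseteq> V" "Y \<noteq> {}" "\<And>e. e \<in> E \<Longrightarrow> e \<subseteq> V \<Longrightarrow> e \<inter> Y \<noteq> {} \<Longrightarrow> e \<subseteq> Y" for Y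
  proof
    assume disj: "Y \<inter> (A \<union> B) = {}"
    obtain y where y: "y \<in> Y" using Y by auto
    then obtain e where e: "e \<in> E" "y \<in> e"
      using Y(1) no_isolated unfolding no_isolated_vertices_def by auto
    obtain a b where ab: "e = {a, b}" "{a, b} \<in> E" using edgeE[OF e(1)] by metis
    have "e \<subseteq> Y" using Y(3)[OF e(1)] edgeD[OF e(1)] e(2) y by auto
    then have "f a \<in> {orig i (u i), orig i (v i)}" "f b \<in> {orig i (u i), orig i (v i)}" "a \<in> V" "b \<in> V"
      using rest disj Y(1) ab by auto
    moreover have "f a \<noteq> f b" using inj_onD[OF injf] edge_pair[OF ab(2)] by auto
    ultimately have "{f a, f b} = orig i ` {u i, v i}" by auto
    then show False using f_edge[OF ab(2)] chosenI[OF i] by simp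
  qed
  have "connected_on E V" unfolding connected_on_def
  proof (intro allI impI, rule ccontr)
    fix Z assume Z: "Z \<subseteq> V" "Z \<noteq> {}" "\<forall>e\<in>E. e \<subseteq> V \<longrightarrow> e \<inter> Z \<noteq> {} \<longrightarrow> e \<subseteq> Z" "Z \<noteq> V"
    have Zc: "e \<subseteq> Z" if "e \<in> E" "e \<subseteq> V" "e \<inter> Z \<noteq> {}" for e using Z(3) that by simp
    have 1: "Z \<inter> (A \<union> B) \<noteq> {}" by (rule meets[OF Z(1,2) Zc])
    have 2: "(V - Z) \<inter> (A \<union> B) \<noteq> {}"
      by (rule meets[OF _ _ closed_complement[OF Zc]]) (use Z in auto)
    have closed: "a \<in> Z \<longleftrightarrow> b \<in> Z" if "a \<in> A" "b \<in> B" for a b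
      using AB[OF that] Z(3) edgeD by blast
    obtain a b where ab: "a \<in> A" "b \<in> B" using A B by auto
    have "x \<in> Z \<longleftrightarrow> a \<in> Z" if "x \<in> A \<union> B" for x
      using that closed[OF ab] closed[of x b] closed[of a x] ab by auto
    then show False using 1 2 by auto
  qed
  then show False using disc disconnected_def by simp
qed

lemma no_copy: False
proof -
  obtain x0 where x0: "x0 \<in> V" using V_ne by auto
  define i where "i = block (f x0)"
  have bl: "block (f x) = i" if "x \<in> V" for x using f_block[OF that x0] i_def by simp
  have i: "i < k" and fV: "f ` V \<subseteq> orig i ` V \<union> flip i ` V"
    using in_block[OF _ bl] fG x0 by (auto simp: image_subset_iff)
  show False
    using no_copy_if_connected[OF i bl fV] no_copy_if_disconnected[OF i fV] by blast
qed

end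

lemma H_free_chosen: "H_free H (delete_edges G chosen)"
proof (rule ccontr)
  assume "\<not> ?thesis"
  then obtain f where "inj_on f V" "f ` V \<subseteq> verts (delete_edges G chosen)"
    "\<And>x y. x \<in> V \<Longrightarrow> y \<in> V \<Longrightarrow> {x, y} \<in> E \<longleftrightarrow> {f x, f y} \<in> edges (delete_edges G chosen)"
    by (rule not_H_freeE) blast
  then show False using no_copy[of f] by (simp add: delete_edges_def)
qed

lemma simple_G:
  assumes "0 < k"
  shows "simple_graph G"
proof -
  have "finite (verts G)" unfolding verts_G using finV by auto
  moreover have "verts G \<noteq> {}" unfolding verts_G using V_ne assms by auto
  moreover have "d \<subseteq> verts G \<and> card d = 2" if "d \<in> edges G" for d
    using that
  proof (cases rule: edge_cases)
    case (orig i x y)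
    then show ?thesis using edge_pair[OF orig(2)] unfolding verts_G by (auto simp: orig_eq)
  next
    case (flip i x y)
    then show ?thesis using edge_pair[OF flip(2)] unfolding verts_G by (auto simp: flip_eq)
  next
    case (cross a b)
    have "a \<noteq> b"
    proof
      assume "a = b"
      then obtain i x y where "i < k" "x \<in> V - {u i, v i}" "y \<in> V - {u i, v i}" "orig i x = flip i y"
        using cross(3) unfolding cross_def by auto
      then show False using orig_eq_flip[of i x y] by auto
    qed
    then show ?thesis using cross by auto
  qed
  ultimately show ?thesis unfolding simple_graph_def by blast
qed

section \<open>Uniqueness of the optimal deletion set of \<open>G\<close>\<close>

definition solves :: "nat set set \<Rightarrow> bool" where
  "solves S \<longleftrightarrow> S \<subseteq> edges G \<and> H_free H (delete_edges G S)"

lemma solves_chosen: "solves chosen"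
  unfolding solves_def using chosen_sub H_free_chosen by simp

lemma finite_edges_G: "finite (edges G)"
proof (cases "0 < k")
  case True
  then show ?thesis using simple_G finite_subset[of "edges G" "Pow (verts G)"]
    unfolding simple_graph_def by auto
next
  case False
  then show ?thesis unfolding edges_G verts_G by simp
qed

lemma solves_hits:
  assumes "solves S" "i < k"
  shows "S \<inter> image (orig i) ` E \<noteq> {}" "S \<inter> image (flip i) ` E \<noteq> {}"
proof -
  have free: "H_free H (delete_edges G S)" using assms(1) unfolding solves_def by simp
  show "S \<inter> image (orig i) ` E \<noteq> {}"
    by (rule H_free_hits_copy[OF simple inj_orig _ orig_edge_iff[OF assms(2)] free])
      (use assms(2) in \<open>auto simp: verts_G\<close>)
  show "S \<inter> image (flip i) ` E \<noteq> {}"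
    by (rule H_free_hits_copy[OF simple inj_flip[OF assms(2)] _ flip_edge_iff[OF assms(2)] free])
      (use assms(2) in \<open>auto simp: verts_G\<close>)
qed

lemma block_image:
  assumes "e \<in> E" shows "block ` orig i ` e = {i}" "block ` flip i ` e = {i}"
proof -
  have "e \<noteq> {}" using edgeD[OF assms] by auto
  then show "block ` orig i ` e = {i}" "block ` flip i ` e = {i}"
    by (simp_all add: image_image image_constant_conv)
qed

lemma shared_edge:
  assumes "i < k" "e \<in> E" "e' \<in> E" "orig i ` e = flip i ` e'"
  shows "orig i ` e = orig i ` {u i, v i}"
proof -
  obtain x y where xy: "e = {x, y}" "{x, y} \<in> E" by (rule edgeE[OF assms(2)])
  have "z = u i \<or> z = v i" if "z \<in> e" for z
  proof -
    have "orig i z \<in> flip i ` e'" using that assms(4) by blast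
    then show ?thesis using orig_eq_flip[OF assms(1)] edgeD[OF assms(2)] edgeD[OF assms(3)] that by blast
  qed
  then have "x = u i \<or> x = v i" "y = u i \<or> y = v i" using xy by auto
  moreover have "x \<noteq> y" using edge_pair[OF xy(2)] by simp
  ultimately show ?thesis using xy(1) by auto
qed

text \<open>Edges that hit copies in different blocks are distinct, so one can be picked injectively
  for each block.\<close>

lemma solution_selector:
  assumes "solves S"
  obtains d where "\<And>i. i < k \<Longrightarrow> d i \<in> S \<inter> image (orig i) ` E" "inj_on d {..<k}"
proof -
  have "\<forall>i\<in>{..<k}. \<exists>e. e \<in> S \<inter> image (orig i) ` E" using solves_hits(1)[OF assms] by blast
  then obtain d where d: "\<And>i. i < k \<Longrightarrow> d i \<in> S \<inter> image (orig i) ` E"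
    by (metis lessThan_iff)
  have "block ` d i = {i}" if "i < k" for i using d[OF that] block_image(1) by auto
  then have "inj_on d {..<k}" by (intro inj_onI) (metis lessThan_iff singleton_inject)
  then show thesis using d that by blast
qed

lemma solves_card_ge:
  assumes "solves S" shows "k \<le> card S"
proof -
  obtain d where d: "\<And>i. i < k \<Longrightarrow> d i \<in> S \<inter> image (orig i) ` E" "inj_on d {..<k}"
    using solution_selector[OF assms] by blast
  have "d ` {..<k} \<subseteq> S" using d(1) by auto
  moreover have "finite S" using assms finite_edges_G finite_subset unfolding solves_def by auto
  ultimately show ?thesis using card_inj_on_le[OF d(2)] by simp
qed

text \<open>A solution of size \<open>k\<close> can afford one edge per block, which must hit the
  original as well as the flipped side. Only the shared edge lies on both.\<close>

lemma solves_unique: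
  assumes S: "solves S" and card: "card S = k"
  shows "S = chosen"
proof -
  obtain d where d: "\<And>i. i < k \<Longrightarrow> d i \<in> S \<inter> image (orig i) ` E" "inj_on d {..<k}"
    using solution_selector[OF S] by blast
  have fin: "finite S" using S finite_edges_G finite_subset unfolding solves_def by auto
  have dS: "d ` {..<k} = S"
    by (rule card_subset_eq[OF fin]) (use d card card_image[OF d(2)] in auto)
  have "d i = orig i ` {u i, v i}" if i: "i < k" for i
  proof -
    obtain c where c: "c \<in> S" "c \<in> image (flip i) ` E" using solves_hits(2)[OF S i] by auto
    then obtain e' where e': "e' \<in> E" "c = flip i ` e'" by auto
    obtain j where j: "j < k" "c = d j" using c(1) dS by auto
    obtain e where e: "e \<in> E" "d j = orig j ` e" using d(1)[OF j(1)] by auto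
    have "j = i" using block_image(1)[OF e(1), of j] block_image(2)[OF e'(1), of i] e(2) e'(2) j(2) by simp
    then show ?thesis using shared_edge[OF i e(1) e'(1)] e e' j by simp
  qed
  then have "d ` {..<k} = chosen" unfolding chosen_def by auto
  then show ?thesis using dS by simp
qed

lemma opt_G: "opt H G = k"
proof -
  have eq: "{S. S \<subseteq> edges G \<and> H_free H (delete_edges G S)} = Collect solves"
    unfolding solves_def by simp
  have "Collect solves \<subseteq> Pow (edges G)" unfolding solves_def by auto
  then have "finite (Collect solves)" using finite_edges_G finite_subset by blast
  then show ?thesis unfolding opt_def eq
    using solves_chosen card_chosen solves_card_ge by (intro Min_eqI) (auto intro!: rev_image_eqI)
qed

section \<open>The online instance and the forced output at the end of the prefix\<close>

text \<open>Sorting makes the arrival order of the prefix the same for all choices of shared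
  edges.\<close>

definition instance_G :: "nat inst" where
  "instance_G = (G, sorted_list_of_set prefix_verts @ sorted_list_of_set (verts G - prefix_verts))"

lemma prefix_sub: "prefix_verts \<subseteq> verts G"
  unfolding prefix_verts_def verts_G by auto

lemma finite_verts_G: "finite (verts G)"
  unfolding verts_G using finV by auto

lemma is_inst_G:
  assumes "0 < k" shows "is_inst instance_G"
  unfolding is_inst_def instance_G_def
  using simple_G[OF assms] finite_verts_G finite_prefix prefix_sub by auto

lemma flip_in_prefix:
  assumes "i < k" "x \<in> V" "flip i x \<in> prefix_verts"
  shows "x = u i \<or> x = v i"
proof -
  obtain j z where z: "flip i x = orig j z" "z \<in> V" using assms(3) unfolding prefix_verts_def by auto
  have "j = i" using arg_cong[OF z(1), of block] by simp
  then show ?thesis using orig_eq_flip[OF assms(1) z(2) assms(2)] z(1) by auto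
qed

text \<open>The only edge of a flipped side within the prefix is the shared one, which is there
  already, and joins inside a block need a new vertex.\<close>

lemma induced_prefix: "induced G prefix_verts = prefix"
proof -
  have "d \<in> edges prefix" if d: "d \<in> edges G" "d \<subseteq> prefix_verts" for d
    using d(1)
  proof (cases rule: edge_cases)
    case (orig i x y)
    then show ?thesis using prefix_edge_iff[OF orig(1), of x y] edge_pair[OF orig(2)] by simp
  next
    case (flip i x y)
    then have "x = u i \<or> x = v i" "y = u i \<or> y = v i"
      using flip_in_prefix d(2) edge_pair[OF flip(2)] by auto
    then have "d = {orig i (u i), orig i (v i)}"
      using flip edge_pair[OF flip(2)] flip_u flip_v[OF flip(1)] by auto
    then show ?thesis using prefix_edge_iff[OF flip(1) uv(1,2)[OF flip(1)]] uvE[OF flip(1)] by simp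
  next
    case (cross a b)
    have ab: "a \<in> prefix_verts" "b \<in> prefix_verts" using cross(4) d(2) by auto
    then have "block a \<noteq> block b"
      using cross(3) flip_in_prefix unfolding cross_def by blast
    then show ?thesis using cross(3,4) ab unfolding prefix_def cross_def by auto
  qed
  moreover have "d \<in> edges G \<and> d \<subseteq> prefix_verts" if "d \<in> edges prefix" for d
  proof -
    from that consider i e where "i < k" "e \<in> E" "d = orig i ` e"
      | a b where "disconnected" "a \<in> prefix_verts" "b \<in> prefix_verts" "block a \<noteq> block b" "d = {a, b}"
      unfolding prefix_def by auto
    then show ?thesis
    proof cases
      case 1
      then show ?thesis using edgeD[OF 1(2)] unfolding edges_G prefix_verts_def by blast
    next
      case 2
      then show ?thesis using prefix_sub unfolding edges_G cross_def by blast
    qed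
  qed
  ultimately have "{d \<in> edges G. d \<subseteq> prefix_verts} = edges prefix" by blast
  then show ?thesis unfolding induced_def by (simp add: prefix_def)
qed

text \<open>Nothing on the right depends on \<open>u\<close> or \<open>v\<close>: up to the end of
  the prefix, all instances look alike to the algorithm.\<close>

lemma revealed_prefix:
  assumes "j \<le> card prefix_verts"
  shows "revealed instance_G j =
    (induced prefix (set (take j (sorted_list_of_set prefix_verts))), take j (sorted_list_of_set prefix_verts))"
proof -
  let ?L = "sorted_list_of_set prefix_verts"
  have tk: "take j (snd instance_G) = take j ?L" using assms by (simp add: instance_G_def)
  have "set (take j ?L) \<subseteq> prefix_verts" using set_take_subset[of j ?L] finite_prefix by simp
  then have "induced (induced G prefix_verts) (set (take j ?L)) = induced G (set (take j ?L))"
    unfolding induced_def by auto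
  then show ?thesis unfolding revealed_def tk induced_prefix by (simp add: instance_G_def)
qed

lemma card_prefix_pos: "0 < k \<Longrightarrow> 0 < card prefix_verts"
  using finite_prefix V_ne by (auto simp: card_gt_0_iff prefix_verts_def)

text \<open>The final output is the unique optimum, so by monotonicity the output at the end of the
  prefix consists of chosen edges. It must hit every copy in the prefix, and each of them contains
  only one chosen edge.\<close>

lemma solution_at_prefix:
  assumes k: "0 < k" and sol: "solution H instance_G Ss" and card: "card (last Ss) = opt H G"
  shows "card prefix_verts \<le> length Ss" "Ss ! (card prefix_verts - 1) = chosen"
proof -
  let ?L = "sorted_list_of_set prefix_verts"
  \<comment> \<open>Outputs are indexed from 0, so this is the index of the first output that
    answers to the whole prefix.\<close>
  define n where "n = card prefix_verts - 1"
  have n: "Suc n = card prefix_verts" using card_prefix_pos[OF k] n_def by simp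
  have len: "length Ss = length (snd instance_G)" using sol unfolding solution_def by simp
  then show le: "card prefix_verts \<le> length Ss" by (simp add: instance_G_def)
  have ne: "Ss \<noteq> []" using le n by auto
  have step: "Ss ! i \<subseteq> edges (fst (revealed instance_G (Suc i))) \<and>
      H_free H (delete_edges (fst (revealed instance_G (Suc i))) (Ss ! i))" if "i < length Ss" for i
    using sol that unfolding solution_def by (simp add: Let_def)
  have set: "set (snd instance_G) = verts G" and fst: "fst instance_G = G"
    using is_inst_G[OF k] unfolding is_inst_def by (auto simp: instance_G_def)
  have whole: "induced G (verts G) = G"
    using simple_G[OF k] unfolding induced_def simple_graph_def by (cases G) auto
  have last: "last Ss = Ss ! (length Ss - 1)" using ne by (rule last_conv_nth)
  have "fst (revealed instance_G (Suc (length Ss - 1))) = G"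
    using ne len set fst whole by (simp add: revealed_def)
  then have "solves (last Ss)" using step[of "length Ss - 1"] ne last unfolding solves_def by simp
  then have last_chosen: "last Ss = chosen" using solves_unique card opt_G by simp
  have mono: "Ss ! i \<subseteq> Ss ! j" if "i \<le> j" "j < length Ss" for i j
    using that
  proof (induction rule: dec_induct)
    case (step m)
    then show ?case using sol unfolding solution_def by (meson Suc_lessD subset_trans)
  qed simp
  have sub: "Ss ! n \<subseteq> chosen" using mono[of n "length Ss - 1"] le n last last_chosen by simp
  have "set (take (Suc n) ?L) = prefix_verts" using n finite_prefix by simp
  moreover have "induced prefix prefix_verts = prefix"
    unfolding induced_prefix[symmetric] by (simp add: induced_def)
  ultimately have "fst (revealed instance_G (Suc n)) = prefix"
    using revealed_prefix[of "Suc n"] n by simp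
  then have free: "H_free H (delete_edges prefix (Ss ! n))" using step[of n] le n by simp
  have "orig i ` {u i, v i} \<in> Ss ! n" if i: "i < k" for i
  proof -
    have "Ss ! n \<inter> image (orig i) ` E \<noteq> {}"
      by (rule H_free_hits_copy[OF simple inj_orig _ prefix_edge_iff[OF i] free])
        (use i in \<open>auto simp: prefix_def prefix_verts_def\<close>)
    then obtain e where e: "e \<in> E" "orig i ` e \<in> Ss ! n" by auto
    then obtain j where j: "orig i ` e = orig j ` {u j, v j}" using sub unfolding chosen_def by auto
    have "j = i" using arg_cong[OF j, of "image block"] block_image(1)[OF e(1), of i] by simp
    then show ?thesis using e(2) j by simp
  qed
  then have "chosen \<subseteq> Ss ! n" unfolding chosen_def by auto
  then show "Ss ! (card prefix_verts - 1) = chosen" using sub n_def by simp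
qed

end

section \<open>Dependence of a run on the advice bits it reads\<close>

text \<open>Bits from position \<open>c'\<close> on are never inspected. The inequality is proved
  along because the induction needs it to place the bits read so far below
  \<open>c'\<close>.\<close>

lemma answers_cong:
  assumes "answers A \<phi> P c c' S" "\<And>n. n < c' \<Longrightarrow> \<psi> n = \<phi> n"
  shows "answers A \<psi> P c c' S \<and> c \<le> c'"
  using assms
proof (induction rule: answers.induct)
  case (out c S)
  then have "map \<psi> [0..<c] = map \<phi> [0..<c]" by simp
  then have "A P (map \<psi> [0..<c]) = Output S" using out.hyps by metis
  then show ?case by (simp add: answers.out)
next
  case (read c c' S)
  then have IH: "answers A \<psi> P (Suc c) c' S" "Suc c \<le> c'" by auto
  then have "map \<psi> [0..<c] = map \<phi> [0..<c]" using read.prems by simp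
  then have "A P (map \<psi> [0..<c]) = Read_Bit" using read.hyps(1) by metis
  then show ?case using answers.read[of A P \<psi> c c' S] IH by simp
qed

lemma steps_cong:
  assumes "steps A \<phi> I c Ss" "\<And>n. n < c \<Longrightarrow> \<psi> n = \<phi> n"
    and "\<And>j. j \<le> length Ss \<Longrightarrow> revealed J j = revealed I j" "length Ss \<le> length (snd J)"
  shows "steps A \<psi> J c Ss"
  using assms
proof (induction rule: steps.induct)
  case start
  then show ?case by (simp add: steps.start)
next
  case (step c Ss c' S)
  have ans: "answers A \<psi> (revealed I (Suc (length Ss))) c c' S" "c \<le> c'"
    using answers_cong[OF step.hyps(3), of \<psi>] step.prems(1) by auto
  have "steps A \<psi> J c Ss"
    by (rule step.IH) (use step.prems ans(2) in auto)
  then show ?case using ans(1) step.prems(2)[of "Suc (length Ss)"] step.prems(3)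
    by (intro steps.step) auto
qed

lemma steps_take:
  assumes "steps A \<phi> I c Ss" "n \<le> length Ss"
  shows "\<exists>c'\<le>c. steps A \<phi> I c' (take n Ss)"
  using assms
proof (induction rule: steps.induct)
  case start
  then show ?case by (auto intro: steps.start)
next
  case (step c Ss c' S)
  show ?case
  proof (cases "n \<le> length Ss")
    case True
    \<comment> \<open>Only the inequality of \<open>answers_cong\<close> is wanted, so the tape is
      compared with itself.\<close>
    moreover have "c \<le> c'" using answers_cong[OF step.hyps(3), of \<phi>] by simp
    ultimately show ?thesis using step.IH by (auto intro: order_trans)
  next
    case False
    then show ?thesis using steps.step[OF step.hyps] step.prems by auto
  qed
qed

text \<open>The run on \<open>J\<close> may read more than \<open>C\<close> bits. It suffices that
  the first \<open>n\<close> steps on \<open>I\<close> read at most \<open>C\<close>: they can be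
  replayed on \<open>J\<close>, and determinism makes them the beginning of the run on
  \<open>J\<close>.\<close>

lemma outputs_determined_by_read_bits:
  assumes run: "run A \<phi> I c Ss" and run': "run A \<psi> J d Ts"
    and bits: "map \<phi> [0..<C] = map \<psi> [0..<C]" "c \<le> C"
    and rev: "\<And>j. j \<le> n \<Longrightarrow> revealed J j = revealed I j"
    and n: "n \<le> length (snd I)" "n \<le> length (snd J)"
  shows "take n Ss = take n Ts"
proof -
  obtain c' where c': "c' \<le> c" "steps A \<phi> I c' (take n Ss)"
    using steps_take[of A \<phi> I c Ss n] run n unfolding run_def by auto
  obtain d' where d': "steps A \<psi> J d' (take n Ts)"
    using steps_take[of A \<psi> J d Ts n] run' n unfolding run_def by auto
  have "steps A \<psi> J c' (take n Ss)"
  proof (rule steps_cong[OF c'(2)])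
    fix m assume "m < c'"
    then show "\<psi> m = \<phi> m" using bits c'(1) by (auto simp: map_eq_conv)
  qed (use rev n in auto)
  moreover have "length (take n Ss) = length (take n Ts)"
    using run run' n unfolding run_def by simp
  ultimately show ?thesis using steps_deterministic[OF _ d'] by blast
qed

section \<open>Counting advice strings\<close>

theorem corollary2:
  fixes H :: "'h graph"
    and A :: "nat online_alg"
    and \<Phi> :: "nat inst \<Rightarrow> tape"
    and k :: nat
  assumes "simple_graph H"
    and "no_isolated_vertices H"
    and "optimal_alg H A"
    and "\<And>I. is_inst I \<Longrightarrow> solves_optimally H A (\<Phi> I) I"
    and "k \<ge> 1"
  shows "\<exists>I c Ss. is_inst I \<and> opt H (fst I) = k \<and> run A (\<Phi> I) I c Ss \<and>
           real c \<ge> real k * log 2 (real (num_edges H))"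
proof -
  have k: "0 < k" using assms(5) by simp
  have finV: "finite (verts H)" using assms(1) unfolding simple_graph_def by simp
  obtain g :: "'h \<Rightarrow> nat" where g: "inj_on g (verts H)"
    using finite_imp_inj_to_nat_seg[OF finV] by auto
  interpret copies H g k by unfold_locales (use assms g in auto)
  \<comment> \<open>An edge is an unordered pair; \<open>ends\<close> fixes an order of its ends,
    from which \<open>u\<close> and \<open>v\<close> are read off.\<close>
  have "\<forall>e\<in>edges H. \<exists>p. e = {fst p, snd p}"
    by (metis edgeE fst_conv snd_conv)
  then obtain ends :: "'h set \<Rightarrow> 'h \<times> 'h" where ends: "\<And>e. e \<in> edges H \<Longrightarrow> {fst (ends e), snd (ends e)} = e"
    by metis
  define u where "u = (\<lambda>F :: nat \<Rightarrow> 'h set. \<lambda>i. fst (ends (F i)))"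
  define v where "v = (\<lambda>F :: nat \<Rightarrow> 'h set. \<lambda>i. snd (ends (F i)))"
  \<comment> \<open>Extensional functions count each choice of one edge per copy once and are
    determined by their values below \<open>k\<close>.\<close>
  define \<F> where "\<F> = PiE {..<k} (\<lambda>_. edges H)"
  have uv: "{u F i, v F i} = F i" if "F \<in> \<F>" "i < k" for F i
    using ends[of "F i"] that unfolding u_def v_def \<F>_def by (auto simp: PiE_def Pi_def)
  have gad: "gadgets H g k (u F) (v F)" if "F \<in> \<F>" for F
    by unfold_locales (use uv[OF that] that in \<open>auto simp: \<F>_def PiE_def Pi_def\<close>)
  define I where "I = (\<lambda>F. gadgets.instance_G H g k (u F) (v F))"
  define N where "N = card prefix_verts"
  have inst: "is_inst (I F)" and optI: "opt H (fst (I F)) = k" if "F \<in> \<F>" for F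
    using gadgets.is_inst_G[OF gad[OF that] k] gadgets.opt_G[OF gad[OF that]]
    unfolding I_def by (auto simp: gadgets.instance_G_def[OF gad[OF that]])
  have "\<exists>c Ss. run A (\<Phi> (I F)) (I F) c Ss \<and> N \<le> length Ss \<and>
      Ss ! (N - 1) = gadgets.chosen g k (u F) (v F)" if F: "F \<in> \<F>" for F
  proof -
    interpret G: gadgets H g k "u F" "v F" by (rule gad[OF F])
    obtain c Ss where "run A (\<Phi> (I F)) (I F) c Ss" "solution H (I F) Ss" "card (last Ss) = opt H (fst (I F))"
      using assms(4)[OF inst[OF F]] unfolding solves_optimally_def by auto
    then show ?thesis using G.solution_at_prefix[OF k, of Ss] unfolding I_def N_def
      by (auto simp: G.instance_G_def)
  qed
  then obtain c Ss where run: "\<And>F. F \<in> \<F> \<Longrightarrow> run A (\<Phi> (I F)) (I F) (c F) (Ss F)"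
    and len: "\<And>F. F \<in> \<F> \<Longrightarrow> N \<le> length (Ss F)"
    and out: "\<And>F. F \<in> \<F> \<Longrightarrow> Ss F ! (N - 1) = gadgets.chosen g k (u F) (v F)"
    by metis
  have E_ne: "edges H \<noteq> {}" using V_ne no_isolated unfolding no_isolated_vertices_def by auto
  have m: "0 < num_edges H" using E_ne finE unfolding num_edges_def by (simp add: card_gt_0_iff)
  have fin\<F>: "finite \<F>" unfolding \<F>_def using finE by (intro finite_PiE) auto
  have card\<F>: "card \<F> = num_edges H ^ k" unfolding \<F>_def num_edges_def by (simp add: card_PiE)
  have ne\<F>: "\<F> \<noteq> {}" using card\<F> m by auto
  \<comment> \<open>An instance on which most bits are read will be the witness. All tapes are
    compared on their first \<open>C\<close> bits, whether or not a particular run reads that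
    far.\<close>
  define C where "C = Max (c ` \<F>)"
  have C: "c F \<le> C" if "F \<in> \<F>" for F using that fin\<F> unfolding C_def by simp
  have "C \<in> c ` \<F>" unfolding C_def using fin\<F> ne\<F> by (intro Max_in) auto
  then obtain F0 where F0: "F0 \<in> \<F>" "c F0 = C" by auto
  have "inj_on (\<lambda>F. map (\<Phi> (I F)) [0..<C]) \<F>"
  proof (rule inj_onI)
    fix F F' assume F: "F \<in> \<F>" and F': "F' \<in> \<F>"
      and eq: "map (\<Phi> (I F)) [0..<C] = map (\<Phi> (I F')) [0..<C]"
    have "take N (Ss F) = take N (Ss F')"
    proof (rule outputs_determined_by_read_bits[OF run[OF F] run[OF F'] eq C[OF F]])
      show "revealed (I F') j = revealed (I F) j" if "j \<le> N" for j
        using gadgets.revealed_prefix[OF gad[OF F]] gadgets.revealed_prefix[OF gad[OF F']] that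
        unfolding I_def N_def by simp
      show "N \<le> length (snd (I F))" "N \<le> length (snd (I F'))"
        using run F F' len unfolding run_def by metis+
    qed
    moreover have "0 < N"
      using gadgets.card_prefix_pos[OF gad[OF F] k] unfolding N_def .
    ultimately have "Ss F ! (N - 1) = Ss F' ! (N - 1)" by (metis diff_less nth_take zero_less_one)
    then have same: "gadgets.chosen g k (u F) (v F) = gadgets.chosen g k (u F') (v F')"
      using out F F' by simp
    \<comment> \<open>The block of a chosen edge reveals its index and \<open>orig i\<close> is
      injective, so the chosen set determines \<open>F\<close>.\<close>
    have "F i = F' i" if i: "i < k" for i
    proof -
      have "orig i ` F i \<in> gadgets.chosen g k (u F) (v F)"
        using gadgets.chosenI[OF gad[OF F] i] uv[OF F i] by simp
      then have "orig i ` F i \<in> (\<lambda>j. orig j ` {u F' j, v F' j}) ` {..<k}"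
        unfolding same gadgets.chosen_def[OF gad[OF F']] .
      then obtain j where j: "j < k" "orig i ` F i = orig j ` F' j"
        using uv[OF F'] by auto
      have FE: "F i \<in> edges H" "F' j \<in> edges H" using F F' i j(1) unfolding \<F>_def by auto
      then have "F i \<noteq> {}" "F' j \<noteq> {}" "F i \<subseteq> verts H" "F' j \<subseteq> verts H" using edgeD by fastforce+
      moreover have "block ` orig i ` F i = block ` orig j ` F' j" using j(2) by simp
      ultimately have "i = j" by (auto simp: image_image)
      then show ?thesis using j(2) inj_on_image_eq_iff[OF inj_orig] FE edgeD by metis
    qed
    then show "F = F'" using F F' unfolding \<F>_def by (intro PiE_ext) auto
  qed
  moreover have "(\<lambda>F. map (\<Phi> (I F)) [0..<C]) ` \<F> \<subseteq> {xs. set xs \<subseteq> UNIV \<and> length xs = C}" by auto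
  ultimately have "card \<F> \<le> card {xs :: bool list. set xs \<subseteq> UNIV \<and> length xs = C}"
    using finite_lists_length_eq[of "UNIV :: bool set" C] by (intro card_inj_on_le) auto
  then have "num_edges H ^ k \<le> 2 ^ C"
    using card_lists_length_eq[of "UNIV :: bool set" C] card\<F> by (simp add: card_UNIV_bool)
  then have "real (num_edges H) ^ k \<le> 2 ^ C"
    by (metis of_nat_le_iff of_nat_numeral of_nat_power)
  then have "log 2 (real (num_edges H) ^ k) \<le> log 2 (2 ^ C)" using m by (intro log_mono) auto
  then have "real k * log 2 (real (num_edges H)) \<le> real C" using m by (simp add: log_nat_power)
  then show ?thesis using inst[OF F0(1)] optI[OF F0(1)] run[OF F0(1)] F0(2) by blast
qed

end
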